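(* Fix $s>1$. If $\gamma_0\in\mathbb{R}$ is such that $Q_{\gamma_0}$ satisfies the matching condition with matching exponents $\kappa^\pm$, and $\gamma_0\notin PM_{\gamma_0}$, then for all $\gamma$ in an open neighborhood of $\gamma_0$ the map $Q_\gamma$ satisfies the same matching condition as $Q_{\gamma_0}$ (that is, with the same exponents $\kappa^\pm$).
   Context: For fixed $s>1$ and $\gamma\in\mathbb{R}$, $Q_\gamma:\mathbb{R}\to\mathbb{R}$ is defined by $Q_\gamma(x)=x+1$ if $x\le\gamma$ and $Q_\gamma(x)=1+s(1-x)$ if $x>\gamma$. Write $Q_\gamma^k(\gamma^{\pm}):=\lim_{x\to\gamma^{\pm}}Q_\gamma^k(x)$ and let $(Q_\gamma^k)'(\gamma^\pm)$ be the one-sided derivatives. $Q_\gamma$ satisfies the matching condition with matching exponents $\kappa^\pm$ (positive integers) if $Q_\gamma^{\kappa^-}(\gamma^-)=Q_\gamma^{\kappa^+}(\gamma^+)$ and $(Q_\gamma^{\kappa^-})'(\gamma^-)=(Q_\gamma^{\kappa^+})'(\gamma^+)$. The prematching set is $PM_\gamma:=\{Q_\gamma^j(\gamma^-):1\le j\le\kappa^--1\}\cup\{Q_\gamma^j(\gamma^+):1\le j\le\kappa^+-1\}$. *)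

theory Defs
  imports "HOL-Analysis.Analysis"
begin

definition Q :: "real \<Rightarrow> real \<Rightarrow> real \<Rightarrow> real" where
  "Q s \<gamma> x = (if x \<le> \<gamma> then x + 1 else 1 + s * (1 - x))"

text \<open>In the next two definitions the filter \<open>F\<close> is \<open>at_left \<gamma>\<close> or \<open>at_right \<gamma>\<close>, which selects
  \<open>\<gamma>\<^sup>-\<close> or \<open>\<gamma>\<^sup>+\<close>. Since the iterates may jump at \<open>\<gamma>\<close>, the difference quotient is based at the
  one-sided limit and not at the value at \<open>\<gamma>\<close>. Lemma \<open>Q_onesided\<close> below shows that, for
  \<open>s > 1\<close>, these limits exist and that \<open>Q_der\<close> is also the one-sided limit of the derivative
  of the iterate.\<close>

definition Q_lim :: "real \<Rightarrow> real \<Rightarrow> nat \<Rightarrow> real filter \<Rightarrow> real" where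
  "Q_lim s \<gamma> k F = Lim F (Q s \<gamma> ^^ k)"

definition Q_der :: "real \<Rightarrow> real \<Rightarrow> nat \<Rightarrow> real filter \<Rightarrow> real" where
  "Q_der s \<gamma> k F = Lim F (\<lambda>x. ((Q s \<gamma> ^^ k) x - Q_lim s \<gamma> k F) / (x - \<gamma>))"

definition matching :: "real \<Rightarrow> real \<Rightarrow> nat \<Rightarrow> nat \<Rightarrow> bool" where
  "matching s \<gamma> \<kappa>m \<kappa>p \<longleftrightarrow> \<kappa>m > 0 \<and> \<kappa>p > 0 \<and>
     Q_lim s \<gamma> \<kappa>m (at_left \<gamma>) = Q_lim s \<gamma> \<kappa>p (at_right \<gamma>) \<and>
     Q_der s \<gamma> \<kappa>m (at_left \<gamma>) = Q_der s \<gamma> \<kappa>p (at_right \<gamma>)"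

definition PM :: "real \<Rightarrow> real \<Rightarrow> nat \<Rightarrow> nat \<Rightarrow> real set" where
  "PM s \<gamma> \<kappa>m \<kappa>p =
     {Q_lim s \<gamma> j (at_left \<gamma>) | j. 1 \<le> j \<and> j \<le> \<kappa>m - 1} \<union>
     {Q_lim s \<gamma> j (at_right \<gamma>) | j. 1 \<le> j \<and> j \<le> \<kappa>p - 1}"

lemma Q_iterate_germ:
  assumes s: "s > 1" and F: "F = at_left \<gamma> \<or> F = at_right \<gamma>"
  shows "\<exists>a b. b \<noteq> 0 \<and> (\<forall>\<^sub>F x in F. (Q s \<gamma> ^^ k) x = a + b * (x - \<gamma>))"
proof (induction k)
  case 0
  show ?case by (rule exI[of _ \<gamma>], rule exI[of _ 1]) auto
next
  case (Suc k)
  then obtain a b where b: "b \<noteq> 0"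
    and ev: "\<forall>\<^sub>F x in F. (Q s \<gamma> ^^ k) x = a + b * (x - \<gamma>)" by blast
  have id: "((\<lambda>x. x) \<longlongrightarrow> \<gamma>) F" using F by (auto intro: tendsto_ident_at)
  have "((\<lambda>x. a + b * (x - \<gamma>)) \<longlongrightarrow> a + b * (\<gamma> - \<gamma>)) F"
    by (intro tendsto_intros id)
  then have lim: "((\<lambda>x. a + b * (x - \<gamma>)) \<longlongrightarrow> a) F" by simp
  have "(\<forall>\<^sub>F x in F. a + b * (x - \<gamma>) \<le> \<gamma>) \<or> (\<forall>\<^sub>F x in F. a + b * (x - \<gamma>) > \<gamma>)"
  proof (cases a \<gamma> rule: linorder_cases)
    case less
    have "\<forall>\<^sub>F x in F. a + b * (x - \<gamma>) \<le> \<gamma>"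
      using order_tendstoD(2)[OF lim less] by eventually_elim simp
    then show ?thesis ..
  next
    case greater
    then show ?thesis using order_tendstoD(1)[OF lim] by blast
  next
    case equal
    have "(\<forall>\<^sub>F x in F. x - \<gamma> < 0) \<or> (\<forall>\<^sub>F x in F. x - \<gamma> > 0)"
      using F by (auto simp: eventually_at_filter)
    then show ?thesis
    proof
      assume ne: "\<forall>\<^sub>F x in F. x - \<gamma> < 0"
      show ?thesis
      proof (cases "b > 0")
        case True
        have "\<forall>\<^sub>F x in F. a + b * (x - \<gamma>) \<le> \<gamma>"
          using ne by eventually_elim (use True equal in \<open>simp add: mult_le_0_iff\<close>)
        then show ?thesis ..
      next
        case False
        have "\<forall>\<^sub>F x in F. a + b * (x - \<gamma>) > \<gamma>"
          using ne by eventually_elim (use False b equal in \<open>simp add: zero_less_mult_iff\<close>)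
        then show ?thesis ..
      qed
    next
      assume po: "\<forall>\<^sub>F x in F. x - \<gamma> > 0"
      show ?thesis
      proof (cases "b > 0")
        case True
        have "\<forall>\<^sub>F x in F. a + b * (x - \<gamma>) > \<gamma>"
          using po by eventually_elim (use True equal in \<open>simp add: zero_less_mult_iff\<close>)
        then show ?thesis ..
      next
        case False
        have "\<forall>\<^sub>F x in F. a + b * (x - \<gamma>) \<le> \<gamma>"
          using po by eventually_elim (use False b equal in \<open>simp add: mult_le_0_iff\<close>)
        then show ?thesis ..
      qed
    qed
  qed
  then show ?case
  proof
    assume "\<forall>\<^sub>F x in F. a + b * (x - \<gamma>) \<le> \<gamma>"
    with ev have "\<forall>\<^sub>F x in F. (Q s \<gamma> ^^ Suc k) x = (a + 1) + b * (x - \<gamma>)"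
      by eventually_elim (simp add: Q_def)
    with b show ?thesis by blast
  next
    assume "\<forall>\<^sub>F x in F. a + b * (x - \<gamma>) > \<gamma>"
    with ev have "\<forall>\<^sub>F x in F. (Q s \<gamma> ^^ Suc k) x = (1 + s * (1 - a)) + (- s * b) * (x - \<gamma>)"
      by eventually_elim (simp add: Q_def, simp add: algebra_simps)
    moreover have "- s * b \<noteq> 0" using s b by simp
    ultimately show ?thesis by blast
  qed
qed

lemma Q_onesided:
  assumes s: "s > 1" and F: "F = at_left \<gamma> \<or> F = at_right \<gamma>"
  shows "((Q s \<gamma> ^^ k) \<longlongrightarrow> Q_lim s \<gamma> k F) F"
    and "((\<lambda>x. ((Q s \<gamma> ^^ k) x - Q_lim s \<gamma> k F) / (x - \<gamma>)) \<longlongrightarrow> Q_der s \<gamma> k F) F"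
    and "((deriv (Q s \<gamma> ^^ k)) \<longlongrightarrow> Q_der s \<gamma> k F) F"
proof -
  obtain a b where ev: "\<forall>\<^sub>F x in F. (Q s \<gamma> ^^ k) x = a + b * (x - \<gamma>)"
    using Q_iterate_germ[OF s F] by blast
  have nb: "\<not> trivial_limit F" using F by (metis trivial_limit_at_left_real trivial_limit_at_right_real)
  have id: "((\<lambda>x. x) \<longlongrightarrow> \<gamma>) F" using F by (auto intro: tendsto_ident_at)
  have "((\<lambda>x. a + b * (x - \<gamma>)) \<longlongrightarrow> a + b * (\<gamma> - \<gamma>)) F"
    by (intro tendsto_intros id)
  then have l: "((Q s \<gamma> ^^ k) \<longlongrightarrow> a) F" using tendsto_cong[OF ev] by simp
  then have a: "Q_lim s \<gamma> k F = a" unfolding Q_lim_def by (rule tendsto_Lim[OF nb])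
  show "((Q s \<gamma> ^^ k) \<longlongrightarrow> Q_lim s \<gamma> k F) F" using l a by simp
  have ne: "\<forall>\<^sub>F x in F. x \<noteq> \<gamma>" using F by (auto simp: eventually_at_filter)
  have "\<forall>\<^sub>F x in F. ((Q s \<gamma> ^^ k) x - Q_lim s \<gamma> k F) / (x - \<gamma>) = b"
    using ev ne by eventually_elim (simp add: a)
  then have d: "((\<lambda>x. ((Q s \<gamma> ^^ k) x - Q_lim s \<gamma> k F) / (x - \<gamma>)) \<longlongrightarrow> b) F"
    by (rule tendsto_eventually)
  then have b: "Q_der s \<gamma> k F = b" unfolding Q_der_def by (rule tendsto_Lim[OF nb])
  show "((\<lambda>x. ((Q s \<gamma> ^^ k) x - Q_lim s \<gamma> k F) / (x - \<gamma>)) \<longlongrightarrow> Q_der s \<gamma> k F) F"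
    using d b by simp
  have der: "deriv (Q s \<gamma> ^^ k) x = b"
    if "open S" "x \<in> S" "\<And>y. y \<in> S \<Longrightarrow> (Q s \<gamma> ^^ k) y = a + b * (y - \<gamma>)" for S x
  proof (rule DERIV_imp_deriv)
    have "((\<lambda>y. a + b * (y - \<gamma>)) has_field_derivative b) (at x)"
      by (auto intro!: derivative_eq_intros)
    then show "((Q s \<gamma> ^^ k) has_field_derivative b) (at x)"
      by (rule has_field_derivative_transform_within_open[OF _ that(1,2)]) (simp add: that(3))
  qed
  have "\<forall>\<^sub>F x in F. deriv (Q s \<gamma> ^^ k) x = b"
    using F
  proof
    assume F: "F = at_left \<gamma>"
    then obtain c where c: "c < \<gamma>" "\<And>y. c < y \<Longrightarrow> y < \<gamma> \<Longrightarrow> (Q s \<gamma> ^^ k) y = a + b * (y - \<gamma>)"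
      using ev by (auto simp: eventually_at_left_field)
    have "\<And>x. c < x \<Longrightarrow> x < \<gamma> \<Longrightarrow> deriv (Q s \<gamma> ^^ k) x = b"
      by (rule der[of "{c<..<\<gamma>}"]) (use c in auto)
    then show ?thesis unfolding F eventually_at_left_field using c(1) by blast
  next
    assume F: "F = at_right \<gamma>"
    then obtain c where c: "c > \<gamma>" "\<And>y. \<gamma> < y \<Longrightarrow> y < c \<Longrightarrow> (Q s \<gamma> ^^ k) y = a + b * (y - \<gamma>)"
      using ev by (auto simp: eventually_at_right_field)
    have "\<And>x. \<gamma> < x \<Longrightarrow> x < c \<Longrightarrow> deriv (Q s \<gamma> ^^ k) x = b"
      by (rule der[of "{\<gamma><..<c}"]) (use c in auto)
    then show ?thesis unfolding F eventually_at_right_field using c(1) by blast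
  qed
  then show "((deriv (Q s \<gamma> ^^ k)) \<longlongrightarrow> Q_der s \<gamma> k F) F"
    unfolding b by (rule tendsto_eventually)
qed

end

theory Submission
  imports Defs
begin

text \<open>The two branches \<open>x + 1\<close> and \<open>1 + s * (1 - x)\<close> do not depend on \<open>\<gamma>\<close>; the parameter only
  decides which of them is applied. Hence, as long as the itinerary of \<open>\<gamma>\<^sup>\<plusminus>\<close> stays the same,
  \<open>Q\<^sub>\<gamma>\<^sup>k(\<gamma>\<^sup>\<plusminus>)\<close> is one fixed affine map evaluated at \<open>\<gamma>\<close>, and the slope of this map is at the same
  time the one-sided derivative of the iterate (\<open>Q_orbit_locally_affine\<close>). The itinerary can
  change only when some intermediate point of the orbit crosses \<open>\<gamma>\<close>. By continuity this does not
  happen close to \<open>\<gamma>\<^sub>0\<close> if no intermediate point equals \<open>\<gamma>\<^sub>0\<close>, which is the hypothesis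
  \<open>\<gamma>\<^sub>0 \<notin> PM\<close>.

  Near \<open>\<gamma>\<^sub>0\<close> the left and the right orbit are therefore both given by affine functions of \<open>\<gamma>\<close>.
  Matching at \<open>\<gamma>\<^sub>0\<close> says that these functions have the same value at \<open>\<gamma>\<^sub>0\<close> and the same slope, so
  they coincide, and with them the values and the derivatives for all nearby \<open>\<gamma>\<close>.\<close>

text \<open>This reduces the computation of both one-sided limits to finding an affine germ, which every
  iterate has by \<open>Q_iterate_germ\<close>.\<close>

lemma Q_lim_der_eqI:
  assumes F: "F = at_left \<gamma> \<or> F = at_right \<gamma>"
    and ev: "\<forall>\<^sub>F x in F. (Q s \<gamma> ^^ k) x = a + b * (x - \<gamma>)"
  shows "Q_lim s \<gamma> k F = a" and "Q_der s \<gamma> k F = b"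
proof -
  have nb: "\<not> trivial_limit F"
    using F by (metis trivial_limit_at_left_real trivial_limit_at_right_real)
  have id: "((\<lambda>x. x) \<longlongrightarrow> \<gamma>) F" using F by (auto intro: tendsto_ident_at)
  have "((\<lambda>x. a + b * (x - \<gamma>)) \<longlongrightarrow> a + b * (\<gamma> - \<gamma>)) F"
    by (intro tendsto_intros id)
  then have "((Q s \<gamma> ^^ k) \<longlongrightarrow> a) F" using tendsto_cong[OF ev] by simp
  then show lim: "Q_lim s \<gamma> k F = a" unfolding Q_lim_def by (rule tendsto_Lim[OF nb])
  have ne: "\<forall>\<^sub>F x in F. x \<noteq> \<gamma>" using F by (auto simp: eventually_at_filter)
  have "\<forall>\<^sub>F x in F. ((Q s \<gamma> ^^ k) x - Q_lim s \<gamma> k F) / (x - \<gamma>) = b"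
    using ev ne by eventually_elim (simp add: lim)
  then have "((\<lambda>x. ((Q s \<gamma> ^^ k) x - Q_lim s \<gamma> k F) / (x - \<gamma>)) \<longlongrightarrow> b) F"
    by (rule tendsto_eventually)
  then show "Q_der s \<gamma> k F = b" unfolding Q_der_def by (rule tendsto_Lim[OF nb])
qed

lemma Q_iterate_eventually_affine:
  assumes "s > 1" and F: "F = at_left \<gamma> \<or> F = at_right \<gamma>"
  shows "\<forall>\<^sub>F x in F. (Q s \<gamma> ^^ k) x = Q_lim s \<gamma> k F + Q_der s \<gamma> k F * (x - \<gamma>)"
  using Q_iterate_germ[OF assms, of k] Q_lim_der_eqI[OF F] by metis

lemma Q_lim_der_1_left:
  "Q_lim s \<gamma> (Suc 0) (at_left \<gamma>) = \<gamma> + 1" "Q_der s \<gamma> (Suc 0) (at_left \<gamma>) = 1"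
proof -
  have "\<forall>\<^sub>F x in at_left \<gamma>. (Q s \<gamma> ^^ Suc 0) x = (\<gamma> + 1) + 1 * (x - \<gamma>)"
    by (auto simp: eventually_at_filter Q_def)
  from Q_lim_der_eqI[OF _ this]
  show "Q_lim s \<gamma> (Suc 0) (at_left \<gamma>) = \<gamma> + 1" "Q_der s \<gamma> (Suc 0) (at_left \<gamma>) = 1" by auto
qed

lemma Q_lim_der_1_right:
  "Q_lim s \<gamma> (Suc 0) (at_right \<gamma>) = 1 + s * (1 - \<gamma>)" "Q_der s \<gamma> (Suc 0) (at_right \<gamma>) = - s"
proof -
  have "\<forall>\<^sub>F x in at_right \<gamma>. (Q s \<gamma> ^^ Suc 0) x = (1 + s * (1 - \<gamma>)) + (- s) * (x - \<gamma>)"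
    by (auto simp: eventually_at_filter Q_def algebra_simps)
  from Q_lim_der_eqI[OF _ this]
  show "Q_lim s \<gamma> (Suc 0) (at_right \<gamma>) = 1 + s * (1 - \<gamma>)" "Q_der s \<gamma> (Suc 0) (at_right \<gamma>) = - s"
    by auto
qed

text \<open>Away from the discontinuity, the orbit of \<open>\<gamma>\<^sup>\<plusminus>\<close> moves like an ordinary orbit: the limit is
  mapped by the branch on its side, and the derivative is multiplied by the slope of that branch.\<close>

lemma Q_lim_der_Suc:
  assumes s: "s > 1" and F: "F = at_left \<gamma> \<or> F = at_right \<gamma>"
  shows "Q_lim s \<gamma> k F < \<gamma> \<Longrightarrow> Q_lim s \<gamma> (Suc k) F = Q_lim s \<gamma> k F + 1 \<and>
           Q_der s \<gamma> (Suc k) F = Q_der s \<gamma> k F"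
    and "Q_lim s \<gamma> k F > \<gamma> \<Longrightarrow> Q_lim s \<gamma> (Suc k) F = 1 + s * (1 - Q_lim s \<gamma> k F) \<and>
           Q_der s \<gamma> (Suc k) F = - s * Q_der s \<gamma> k F"
proof -
  note lim = Q_onesided(1)[OF s F, of k]
  note aff = Q_iterate_eventually_affine[OF s F, of k]
  {
    assume "Q_lim s \<gamma> k F < \<gamma>"
    from order_tendstoD(2)[OF lim this] aff
    have "\<forall>\<^sub>F x in F. (Q s \<gamma> ^^ Suc k) x = (Q_lim s \<gamma> k F + 1) + Q_der s \<gamma> k F * (x - \<gamma>)"
      by eventually_elim (simp add: Q_def)
    from Q_lim_der_eqI[OF F this]
    show "Q_lim s \<gamma> (Suc k) F = Q_lim s \<gamma> k F + 1 \<and> Q_der s \<gamma> (Suc k) F = Q_der s \<gamma> k F" by simp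
  next
    assume "Q_lim s \<gamma> k F > \<gamma>"
    from order_tendstoD(1)[OF lim this] aff
    have "\<forall>\<^sub>F x in F. (Q s \<gamma> ^^ Suc k) x =
        (1 + s * (1 - Q_lim s \<gamma> k F)) + (- s * Q_der s \<gamma> k F) * (x - \<gamma>)"
      by eventually_elim (simp add: Q_def, simp add: algebra_simps)
    from Q_lim_der_eqI[OF F this]
    show "Q_lim s \<gamma> (Suc k) F = 1 + s * (1 - Q_lim s \<gamma> k F) \<and>
        Q_der s \<gamma> (Suc k) F = - s * Q_der s \<gamma> k F" by simp
  }
qed

text \<open>The same number \<open>b\<close> is the derivative in \<open>x\<close> of the iterate and the rate at which the limit
  moves with the parameter: the point \<open>\<gamma>\<^sup>\<plusminus>\<close> moves with speed one, and the branches applied to it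
  are independent of the parameter. In the induction, the hypothesis that the orbit avoids \<open>\<gamma>\<^sub>0\<close>
  fixes the branch of the next step on a whole neighbourhood. The time \<open>0\<close> is left out since
  \<open>Q\<^sub>\<gamma>\<^sup>0(\<gamma>\<^sup>\<plusminus>) = \<gamma>\<close>; the first branch is determined by the side alone.\<close>

lemma Q_orbit_locally_affine:
  fixes side :: "real \<Rightarrow> real filter"
  assumes s: "s > 1" and side: "side = at_left \<or> side = at_right"
    and "1 \<le> k" and "\<And>j. 1 \<le> j \<Longrightarrow> j < k \<Longrightarrow> Q_lim s \<gamma>0 j (side \<gamma>0) \<noteq> \<gamma>0"
  shows "\<exists>a b. \<forall>\<^sub>F \<gamma> in nhds \<gamma>0.
           Q_lim s \<gamma> k (side \<gamma>) = a + b * (\<gamma> - \<gamma>0) \<and> Q_der s \<gamma> k (side \<gamma>) = b"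
  using assms(3,4)
proof (induction k rule: nat_induct_at_least)
  case base
  show ?case
    using side
  proof
    assume "side = at_left"
    then show ?thesis
      by (intro exI[of _ "\<gamma>0 + 1"] exI[of _ 1]) (simp add: Q_lim_der_1_left)
  next
    assume "side = at_right"
    then show ?thesis
      by (intro exI[of _ "1 + s * (1 - \<gamma>0)"] exI[of _ "- s"])
        (simp add: Q_lim_der_1_right algebra_simps)
  qed
next
  case (Suc k)
  have F: "side \<gamma> = at_left \<gamma> \<or> side \<gamma> = at_right \<gamma>" for \<gamma> using side by auto
  obtain a b where ev: "\<forall>\<^sub>F \<gamma> in nhds \<gamma>0.
      Q_lim s \<gamma> k (side \<gamma>) = a + b * (\<gamma> - \<gamma>0) \<and> Q_der s \<gamma> k (side \<gamma>) = b"
    using Suc.IH Suc.prems by force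
  have "Q_lim s \<gamma>0 k (side \<gamma>0) = a" using eventually_nhds_x_imp_x[OF ev] by simp
  with Suc.prems[of k] Suc.hyps have "a \<noteq> \<gamma>0" by simp
  have "((\<lambda>\<gamma>. a + b * (\<gamma> - \<gamma>0) - \<gamma>) \<longlongrightarrow> a + b * (\<gamma>0 - \<gamma>0) - \<gamma>0) (nhds \<gamma>0)"
    by (intro tendsto_intros filterlim_ident)
  then have gap: "((\<lambda>\<gamma>. a + b * (\<gamma> - \<gamma>0) - \<gamma>) \<longlongrightarrow> a - \<gamma>0) (nhds \<gamma>0)" by simp
  show ?case
  proof (cases "a < \<gamma>0")
    case True
    then have "\<forall>\<^sub>F \<gamma> in nhds \<gamma>0. a + b * (\<gamma> - \<gamma>0) - \<gamma> < 0" by (intro order_tendstoD(2)[OF gap]) simp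
    with ev have "\<forall>\<^sub>F \<gamma> in nhds \<gamma>0. Q_lim s \<gamma> (Suc k) (side \<gamma>) = (a + 1) + b * (\<gamma> - \<gamma>0) \<and>
        Q_der s \<gamma> (Suc k) (side \<gamma>) = b"
      by eventually_elim (use Q_lim_der_Suc(1)[OF s F] in force)
    then show ?thesis by blast
  next
    case False
    with \<open>a \<noteq> \<gamma>0\<close> have "\<forall>\<^sub>F \<gamma> in nhds \<gamma>0. a + b * (\<gamma> - \<gamma>0) - \<gamma> > 0"
      by (intro order_tendstoD(1)[OF gap]) simp
    with ev have "\<forall>\<^sub>F \<gamma> in nhds \<gamma>0.
        Q_lim s \<gamma> (Suc k) (side \<gamma>) = (1 + s * (1 - a)) + (- s * b) * (\<gamma> - \<gamma>0) \<and>
        Q_der s \<gamma> (Suc k) (side \<gamma>) = - s * b"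
    proof eventually_elim
      case (elim \<gamma>)
      then have "Q_lim s \<gamma> k (side \<gamma>) > \<gamma>" by simp
      from Q_lim_der_Suc(2)[OF s F this] elim(1) show ?case by (simp add: algebra_simps)
    qed
    then show ?thesis by blast
  qed
qed

theorem proposition1:
  fixes s \<gamma>0 :: real and \<kappa>m \<kappa>p :: nat
  assumes "s > 1"
    and "matching s \<gamma>0 \<kappa>m \<kappa>p"
    and "\<gamma>0 \<notin> PM s \<gamma>0 \<kappa>m \<kappa>p"
  shows "\<exists>U. open U \<and> \<gamma>0 \<in> U \<and> (\<forall>\<gamma>\<in>U. matching s \<gamma> \<kappa>m \<kappa>p)"
proof -
  have pos: "\<kappa>m > 0" "\<kappa>p > 0" using assms(2) by (auto simp: matching_def)
  have "Q_lim s \<gamma>0 j (at_left \<gamma>0) \<noteq> \<gamma>0" if "1 \<le> j" "j < \<kappa>m" for j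
  proof -
    have "j \<le> \<kappa>m - 1" using that by simp
    with that assms(3) show ?thesis unfolding PM_def by force
  qed
  then obtain am bm where m: "\<forall>\<^sub>F \<gamma> in nhds \<gamma>0.
      Q_lim s \<gamma> \<kappa>m (at_left \<gamma>) = am + bm * (\<gamma> - \<gamma>0) \<and> Q_der s \<gamma> \<kappa>m (at_left \<gamma>) = bm"
    using Q_orbit_locally_affine[OF assms(1), of at_left \<kappa>m \<gamma>0] pos by auto
  have "Q_lim s \<gamma>0 j (at_right \<gamma>0) \<noteq> \<gamma>0" if "1 \<le> j" "j < \<kappa>p" for j
  proof -
    have "j \<le> \<kappa>p - 1" using that by simp
    with that assms(3) show ?thesis unfolding PM_def by force
  qed
  then obtain ap bp where p: "\<forall>\<^sub>F \<gamma> in nhds \<gamma>0.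
      Q_lim s \<gamma> \<kappa>p (at_right \<gamma>) = ap + bp * (\<gamma> - \<gamma>0) \<and> Q_der s \<gamma> \<kappa>p (at_right \<gamma>) = bp"
    using Q_orbit_locally_affine[OF assms(1), of at_right \<kappa>p \<gamma>0] pos by auto
  have same: "am = ap" "bm = bp"
    using assms(2) eventually_nhds_x_imp_x[OF m] eventually_nhds_x_imp_x[OF p]
    by (auto simp: matching_def)
  from m p have "\<forall>\<^sub>F \<gamma> in nhds \<gamma>0. matching s \<gamma> \<kappa>m \<kappa>p"
    by eventually_elim (use pos same in \<open>simp add: matching_def\<close>)
  then show ?thesis by (auto simp: eventually_nhds)
qed

end
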